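(* Let $p$ be a prime and let $k,n$ be nonnegative integers. (1) If $p\equiv 1 \pmod 3$, then \[B_{3}(p^{k}n+p^{k}-1)=\frac{p^{2k}-1}{p^2-1}B_{3}(pn+p-1)-\frac{p^{2k}-p^2}{p^2-1}B_{3}(n).\] (2) If $p\equiv 2 \pmod 3$, then \[B_{3}(p^{k}n+p^k-1)=\frac{p^{2k}-(-1)^{k}}{p^2+1}B_{3}(pn+p-1)+\frac{p^{2k}+(-1)^{k}p^2}{p^2+1}B_{3}(n).\]
   Context: A partition $\lambda$ of a nonnegative integer is called a $3$-core if none of its hook lengths is divisible by $3$. $B_3(n)$ denotes the number of ordered triples $(\lambda_1,\lambda_2,\lambda_3)$ of partitions, each a $3$-core, whose sizes sum to $n$; equivalently $\sum_{n\ge0}B_3(n)q^n=\frac{(q^3;q^3)_\infty^{9}}{(q;q)_\infty^{3}}$, where $(a;q)_\infty=\prod_{k\ge0}(1-aq^k)$. *)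

theory Defs
  imports "HOL-Computational_Algebra.Computational_Algebra"
begin

text \<open>Generating function of B_3:
  sum B_3(n) q^n = (q^3;q^3)_inf^9 / (q;q)_inf^3 = prod_{k>=1} (1-q^(3k))^9 / (1-q^k)^3.
  The factors with k > n are congruent to 1 modulo q^(n+1), so the n-th coefficient
  of the infinite product equals the n-th coefficient of the finite product over k = 1..n.\<close>

definition B3_factor :: "nat \<Rightarrow> real fps" where
  "B3_factor k = (1 - fps_X ^ (3 * k)) ^ 9 * (inverse (1 - fps_X ^ k)) ^ 3"

definition B3 :: "nat \<Rightarrow> real" where
  "B3 n = fps_nth (\<Prod>k\<in>{1..n}. B3_factor k) n"

end

theory Submission
  imports Defs
begin

text \<open>With chi the quadratic character modulo 3, B3 n is the coefficient f (n + 1) of the weight 3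
  Eisenstein series, f N being the sum of chi a * d^2 over all factorizations N = a * d. For f the
  formulas follow from f (p N) = p^2 f N + chi p h N and h (p N) = chi p h N, where h collects the
  terms with d prime to p.

  The equality B3 n = f (n + 1) needs no modular forms. The logarithmic derivative of the product
  gives n B3 n = 3 (sum of s k * B3 (n - k) for 1 <= k <= n), where s k is the sum over the
  divisors a of k of a * weight3 a. So it suffices that f satisfies the same recurrence, i.e. to
  evaluate the sum of a * weight3 a * chi b * y^2 over the positive solutions of a x + b y = N.
  This is done by Liouville's method: (a, b, x, y) |-> (a + b, b, x, y - x) maps the solutions with
  x < y onto those with b < a, so that for a suitable function Phi the sum of
  Phi a b x y - Phi (a - b) b x (x + y) reduces to the diagonals x = y and a = b.\<close>

subsection \<open>The character modulo 3\<close>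

definition chi :: "int \<Rightarrow> int" where
  "chi a = (if a mod 3 = 1 then 1 else if a mod 3 = 2 then -1 else 0)"

lemma chi_values: "chi 0 = 0" "chi 1 = 1" "chi 2 = - 1" "chi 3 = 0" "chi 4 = 1" "chi (- 1) = - 1" "chi (- 2) = 1"
  by (simp_all add: chi_def)

lemma mod3_cases:
  fixes a :: int
  obtains r k where "a = r + 3 * k" "r \<in> {0, 1, 2}"
proof -
  have "a mod 3 = 0 \<or> a mod 3 = 1 \<or> a mod 3 = 2" by presburger
  then show ?thesis using that[of "a mod 3" "a div 3"] by simp
qed

lemma chi_add_3: "chi (a + 3 * k) = chi a"
  unfolding chi_def by simp

lemma chi_minus: "chi (- a) = - chi a"
proof (rule mod3_cases[of a])
  fix r k assume a: "a = r + 3 * k" "r \<in> {0, 1, 2}"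
  then have "- a = - r + 3 * (- k)" by simp
  then have "chi (- a) = chi (- r)" by (simp only: chi_add_3)
  then show ?thesis
    using a(2) unfolding a(1) chi_add_3 by (auto simp: chi_values)
qed

lemma chi_sum_consecutive: "chi a + chi (a + 1) + chi (a + 2) = 0"
proof (rule mod3_cases[of a])
  fix r k assume a: "a = r + 3 * k" "r \<in> {0, 1, 2}"
  then have "a + 1 = (r + 1) + 3 * k" "a + 2 = (r + 2) + 3 * k" by simp_all
  then have "chi (a + 1) = chi (r + 1)" "chi (a + 2) = chi (r + 2)" by (simp_all only: chi_add_3)
  then show ?thesis
    using a(2) unfolding a(1) chi_add_3 by (auto simp: chi_values)
qed

lemma chi_diff_swap: "chi (b - a) = - chi (a - b)"
  using chi_minus[of "a - b"] by simp

text \<open>Since -2 = 1 modulo 3, the shift \<open>a - b\<close> for \<open>a\<close> turns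
  \<open>chi (a - b)\<close> into \<open>chi (a + b)\<close>, so no new character values appear in
  the shifted \<open>Phi\<close>.\<close>

lemma chi_diff_double: "chi (a - 2 * b) = chi (a + b)"
  using chi_add_3[of "a - 2 * b" b] by (simp add: algebra_simps)

lemma chi_mult: "chi (a * b) = chi a * chi b"
proof (rule mod3_cases[of a], rule mod3_cases[of b])
  fix r k s l assume a: "a = r + 3 * k" "r \<in> {0, 1, 2}" and b: "b = s + 3 * l" "s \<in> {0, 1, 2}"
  have "a * b = r * s + 3 * (r * l + k * s + 3 * k * l)"
    unfolding a b by (simp add: algebra_simps)
  then have "chi (a * b) = chi (r * s)" by (simp only: chi_add_3)
  then show ?thesis
    using a(2) b(2) unfolding a(1) b(1) chi_add_3 by (auto simp: chi_values)
qed

text \<open>The negated sum of \<open>w ^ a\<close> over the two primitive cube roots of unity w,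
  equivalently 1 - 3 [3 dvd a].\<close>

definition weight3 :: "int \<Rightarrow> int" where
  "weight3 a = (if 3 dvd a then -2 else 1)"

text \<open>Both sides depend only on residues modulo 3, so nine cases suffice. The product becomes
  linear in characters of \<open>a - b\<close> and \<open>a + b\<close>, the form in which
  \<open>Phi\<close> produces it.\<close>

lemma weight3_chi: "weight3 a * chi b = chi (a - b) - chi (a + b)"
proof (rule mod3_cases[of a], rule mod3_cases[of b])
  fix r k s l assume a: "a = r + 3 * k" "r \<in> {0, 1, 2}" and b: "b = s + 3 * l" "s \<in> {0, 1, 2}"
  have "a - b = (r - s) + 3 * (k - l)" "a + b = (r + s) + 3 * (k + l)"
    unfolding a b by (simp_all add: algebra_simps)
  then have "chi (a - b) = chi (r - s)" "chi (a + b) = chi (r + s)" by (simp_all only: chi_add_3)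
  moreover have "weight3 a = (if r = 0 then -2 else 1)"
    using a(2) unfolding a(1) weight3_def by (auto simp: dvd_add_left_iff)
  ultimately show ?thesis
    using a(2) b(2) unfolding b(1) chi_add_3 by (auto simp: chi_values)
qed

subsection \<open>A convolution identity by Liouville's method\<close>

definition factor_pairs :: "int \<Rightarrow> (int \<times> int) set" where
  "factor_pairs N = {(a, d). 0 < a \<and> 0 < d \<and> a * d = N}"

definition quads :: "int \<Rightarrow> (int \<times> int \<times> int \<times> int) set" where
  "quads N = {(a, b, x, y). 0 < a \<and> 0 < b \<and> 0 < x \<and> 0 < y \<and> a * x + b * y = N}"

definition eis :: "int \<Rightarrow> int" where
  "eis N = (\<Sum>(a, d)\<in>factor_pairs N. chi a * d\<^sup>2)"

text \<open>For positive N this is sigma(N) - 9 sigma(N/3), the second term being 0 unless 3 divides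
  N.\<close>

definition wsigma :: "int \<Rightarrow> int" where
  "wsigma N = (\<Sum>(a, d)\<in>factor_pairs N. a * weight3 a)"

lemma pos_mult_bounds:
  fixes a d :: int
  assumes "0 < a" "0 < d"
  shows "a \<le> a * d" "d \<le> a * d"
  using assms mult_left_mono[of 1 d a] mult_right_mono[of 1 a d] by auto

lemma finite_factor_pairs [simp]: "finite (factor_pairs N)"
proof (rule finite_subset)
  show "factor_pairs N \<subseteq> {1..N} \<times> {1..N}"
    unfolding factor_pairs_def using pos_mult_bounds by fastforce
qed auto

text \<open>With k = a x, a solution is a factorization of k together with one of N - k; positivity
  of both products confines k to 1..N-1.\<close>

lemma sum_quads_convolution:
  "(\<Sum>q\<in>quads N. g q) =
    (\<Sum>k\<in>{1..N - 1}. \<Sum>(a, x)\<in>factor_pairs k. \<Sum>(b, y)\<in>factor_pairs (N - k). g (a, b, x, y))"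
proof -
  have "(\<Sum>k\<in>{1..N - 1}. \<Sum>(a, x)\<in>factor_pairs k. \<Sum>(b, y)\<in>factor_pairs (N - k). g (a, b, x, y))
     = (\<Sum>(k, (a, x), (b, y))\<in>(SIGMA k:{1..N - 1}. factor_pairs k \<times> factor_pairs (N - k)). g (a, b, x, y))"
    by (simp add: sum.Sigma sum.cartesian_product case_prod_beta)
  also have "\<dots> = (\<Sum>q\<in>quads N. g q)"
  proof (rule sum.reindex_bij_witness[where
        i = "\<lambda>(a, b, x, y). (a * x, (a, x), (b, y))" and j = "\<lambda>(k, (a, x), (b, y)). (a, b, x, y)"])
    fix q assume "q \<in> quads N"
    then obtain a b x y where q: "q = (a, b, x, y)" "0 < a" "0 < b" "0 < x" "0 < y" "a * x + b * y = N"
      by (auto simp: quads_def)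
    then have "0 < a * x" "0 < b * y" by simp_all
    then have "1 \<le> a * x" "1 \<le> b * y" by linarith+
    then show "(case q of (a, b, x, y) \<Rightarrow> (a * x, (a, x), (b, y)))
        \<in> (SIGMA k:{1..N - 1}. factor_pairs k \<times> factor_pairs (N - k))"
      using q by (auto simp: factor_pairs_def)
  qed (auto simp: quads_def factor_pairs_def)
  finally show ?thesis ..
qed

lemma finite_quads [simp]: "finite (quads N)"
proof (rule finite_subset)
  show "quads N \<subseteq> (\<lambda>(k, (a, x), (b, y)). (a, b, x, y)) `
      (SIGMA k:{1..N - 1}. factor_pairs k \<times> factor_pairs (N - k))"
  proof
    fix q assume "q \<in> quads N"
    then obtain a b x y where q: "q = (a, b, x, y)" "0 < a" "0 < b" "0 < x" "0 < y" "a * x + b * y = N"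
      by (auto simp: quads_def)
    then have "0 < a * x" "0 < b * y" by simp_all
    then have "1 \<le> a * x" "1 \<le> b * y" by linarith+
    then have "(a * x, (a, x), (b, y)) \<in> (SIGMA k:{1..N - 1}. factor_pairs k \<times> factor_pairs (N - k))"
      using q by (auto simp: factor_pairs_def)
    then show "q \<in> (\<lambda>(k, (a, x), (b, y)). (a, b, x, y)) `
      (SIGMA k:{1..N - 1}. factor_pairs k \<times> factor_pairs (N - k))"
      using q by (intro image_eqI[where x = "(a * x, (a, x), (b, y))"]) auto
  qed
qed auto

text \<open>Phi was found by linear algebra among the cubic polynomials with coefficients depending on
  (a, b) modulo 3. Two symmetries are needed: invariance under exchanging (a, x) with (b, y), and
  under (a, b, x, y) |-> (- a, a + b, y - x, y), which makes the shifted function symmetric as well;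
  the two halves x < y, y < x then match the halves b < a, a < b.\<close>

definition Phi :: "int \<Rightarrow> int \<Rightarrow> int \<Rightarrow> int \<Rightarrow> int" where
  "Phi a b x y = - chi a * a * y\<^sup>2 - chi b * b * x\<^sup>2 - chi (a + b) * (a + b) * (x - y)\<^sup>2
     + chi (a - b) * (b * y\<^sup>2 + 2 * a * y\<^sup>2 - 2 * a * x * y - a * x\<^sup>2 - 2 * b * x\<^sup>2 + 2 * b * x * y)"

lemma Phi_swap: "Phi b a y x = Phi a b x y"
  unfolding Phi_def chi_diff_swap[of b a] by (simp add: algebra_simps power2_eq_square)

lemma Phi_shift: "Phi (a - b) b x (x + y) =
  - chi (a - b) * (a - b) * (x + y)\<^sup>2 - chi b * b * x\<^sup>2 - chi a * a * y\<^sup>2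
  + chi (a + b) * (b * (x + y)\<^sup>2 + 2 * (a - b) * (x + y)\<^sup>2 - 2 * (a - b) * x * (x + y)
      - (a - b) * x\<^sup>2 - 2 * b * x\<^sup>2 + 2 * b * x * (x + y))"
  using chi_diff_double[of a b] by (simp add: Phi_def algebra_simps)

lemma Phi_shift_swap: "Phi (b - a) a y (y + x) = Phi (a - b) b x (x + y)"
  unfolding Phi_shift chi_diff_swap[of b a] add.commute[of b a]
  by (simp add: algebra_simps power2_eq_square)

text \<open>The purpose of \<open>Phi\<close>: the mixed terms cancel, leaving three times
  \<open>a * weight3 a * chi b * y^2\<close> plus its image under exchanging (a, x) with (b,
  y).\<close>

lemma Phi_minus_shift:
  "Phi a b x y - Phi (a - b) b x (x + y) =
    3 * (a * (chi (a - b) - chi (a + b)) * y\<^sup>2) + 3 * (b * (chi (b - a) - chi (b + a)) * x\<^sup>2)"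
  unfolding Phi_shift chi_diff_swap[of b a] add.commute[of b a]
  by (simp add: Phi_def algebra_simps power2_eq_square)

section \<open>Bijections between regions of solutions, and the diagonals\<close>

lemma sum_quads_swap: "(\<Sum>(a, b, x, y)\<in>{(a, b, x, y)\<in>quads N. P b a y x}. g b a y x)
   = (\<Sum>(a, b, x, y)\<in>{(a, b, x, y)\<in>quads N. P a b x y}. g a b x y)"
  by (rule sum.reindex_bij_witness[where
        i = "\<lambda>(a, b, x, y). (b, a, y, x)" and j = "\<lambda>(a, b, x, y). (b, a, y, x)"])
     (auto simp: quads_def)

text \<open>The equation is preserved because (a + b) x + b (y - x) = a x + b y; positivity of y - x
  on one side corresponds to positivity of a - b on the other.\<close>

lemma sum_quads_shift:
  "(\<Sum>(a, b, x, y)\<in>{(a, b, x, y)\<in>quads N. x < y}. g a b x y)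
   = (\<Sum>(a, b, x, y)\<in>{(a, b, x, y)\<in>quads N. b < a}. g (a - b) b x (x + y))"
  by (rule sum.reindex_bij_witness[where
        i = "\<lambda>(a, b, x, y). (a - b, b, x, x + y)" and j = "\<lambda>(a, b, x, y). (a + b, b, x, y - x)"])
     (auto simp: quads_def algebra_simps)

text \<open>For x = y the equation reads (a + b) x = N: a factorization of N with a splitting of its
  first factor.\<close>

lemma sum_quads_diagonal_right:
  "(\<Sum>(a, b, x, y)\<in>{(a, b, x, y)\<in>quads N. x = y}. g a b x y)
   = (\<Sum>(m, x)\<in>factor_pairs N. \<Sum>a\<in>{1..m - 1}. g a (m - a) x x)"
proof -
  have "(\<Sum>(m, x)\<in>factor_pairs N. \<Sum>a\<in>{1..m - 1}. g a (m - a) x x)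
     = (\<Sum>((m, x), a)\<in>(SIGMA p:factor_pairs N. {1..fst p - 1}). g a (m - a) x x)"
    by (simp add: sum.Sigma case_prod_beta)
  also have "\<dots> = (\<Sum>(a, b, x, y)\<in>{(a, b, x, y)\<in>quads N. x = y}. g a b x y)"
    by (rule sum.reindex_bij_witness[where
        i = "\<lambda>(a, b, x, y). ((a + b, x), a)" and j = "\<lambda>((m, x), a). (a, m - a, x, x)"])
       (auto simp: quads_def factor_pairs_def algebra_simps)
  finally show ?thesis ..
qed

text \<open>For a = b the equation reads a (x + y) = N, so now the second factor is split.\<close>

lemma sum_quads_diagonal_left:
  "(\<Sum>(a, b, x, y)\<in>{(a, b, x, y)\<in>quads N. a = b}. g a b x y)
   = (\<Sum>(a, d)\<in>factor_pairs N. \<Sum>x\<in>{1..d - 1}. g a a x (d - x))"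
proof -
  have "(\<Sum>(a, d)\<in>factor_pairs N. \<Sum>x\<in>{1..d - 1}. g a a x (d - x))
     = (\<Sum>((a, d), x)\<in>(SIGMA p:factor_pairs N. {1..snd p - 1}). g a a x (d - x))"
    by (simp add: sum.Sigma case_prod_beta)
  also have "\<dots> = (\<Sum>(a, b, x, y)\<in>{(a, b, x, y)\<in>quads N. a = b}. g a b x y)"
    by (rule sum.reindex_bij_witness[where
        i = "\<lambda>(a, b, x, y). ((a, x + y), x)" and j = "\<lambda>((a, d), x). (a, a, x, d - x)"])
       (auto simp: quads_def factor_pairs_def algebra_simps)
  finally show ?thesis ..
qed

section \<open>Values of \<open>Phi\<close> and its shift on the diagonals\<close>

text \<open>With m = n + 1 and a = i + 1, the three arguments are a, m - a and a - (m - a). The last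
  ones all have the parity of n + 1, hence the induction in steps of two.\<close>

lemma sum_chi_mult_triple:
  fixes n :: nat
  defines "h \<equiv> \<lambda>a. chi a * a"
  shows "(\<Sum>i<n. h (int i + 1) + h (int n - int i) + h (2 * int i + 1 - int n)) = - 2 * int n * chi (int n + 1)"
proof (induction n rule: nat_induct2)
  case 0
  show ?case by simp
next
  case 1
  show ?case by (simp add: h_def chi_def)
next
  case (step n)
  define H1 where "H1 = (\<lambda>n. \<Sum>i<n. h (int i + 1))"
  define H2 where "H2 = (\<lambda>n. \<Sum>i<n. h (int n - int i))"
  define H3 where "H3 = (\<lambda>n. \<Sum>i<n. h (2 * int i + 1 - int n))"
  have 1: "H1 (Suc (Suc n)) = H1 n + h (int n + 1) + h (int n + 2)"
    unfolding H1_def by (simp add: algebra_simps)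
  have 2: "H2 (Suc (Suc n)) = H2 n + h (int n + 1) + h (int n + 2)"
    unfolding H2_def by (simp add: sum.lessThan_Suc_shift algebra_simps del: sum.lessThan_Suc)
  \<comment> \<open>The arguments now run from -(n + 1) to n + 1 in steps of two; the two new end
    terms agree because \<open>h\<close> is even.\<close>
  have 3: "H3 (Suc (Suc n)) = H3 n + 2 * h (int n + 1)"
  proof -
    have "H3 (Suc (Suc n)) = h (- (int n + 1)) + (\<Sum>i<Suc n. h (2 * int i + 1 - int n))"
      unfolding H3_def by (subst sum.lessThan_Suc_shift) (simp add: algebra_simps)
    then show ?thesis
      unfolding H3_def h_def chi_minus by (simp add: algebra_simps)
  qed
  have "H1 n + H2 n + H3 n = - 2 * int n * chi (int n + 1)"
    using step unfolding H1_def H2_def H3_def by (simp add: sum.distrib)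
  then have "H1 (Suc (Suc n)) + H2 (Suc (Suc n)) + H3 (Suc (Suc n))
     = - 2 * int n * chi (int n + 1) + 4 * h (int n + 1) + 2 * h (int n + 2)"
    unfolding 1 2 3 by simp
  also have "\<dots> = 2 * (int n + 2) * (chi (int n + 1) + chi (int n + 2))"
    unfolding h_def by (simp add: algebra_simps)
  also have "chi (int n + 1) + chi (int n + 2) = - chi (int n + 3)"
    using chi_sum_consecutive[of "int n + 1"] by (simp add: algebra_simps)
  finally show ?case
    unfolding H1_def H2_def H3_def by (simp add: sum.distrib algebra_simps)
qed

text \<open>At x = y the term with (x - y)^2 vanishes and the bracket at \<open>chi (a - b)\<close>
  collapses to (b - a) x^2, leaving -x^2 times the summand of
  \<open>sum_chi_mult_triple\<close>.\<close>

lemma sum_Phi_diagonal_right: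
  assumes "0 < m"
  shows "(\<Sum>a\<in>{1..m - 1}. Phi a (m - a) x x) = 2 * (m - 1) * chi m * x\<^sup>2"
proof -
  define n where "n = nat (m - 1)"
  have m: "m = int n + 1" using assms by (simp add: n_def)
  let ?h = "\<lambda>a. chi a * a"
  have "(\<Sum>a\<in>{1..m - 1}. Phi a (m - a) x x)
      = (\<Sum>i<n. Phi (int i + 1) (m - (int i + 1)) x x)"
    by (rule sum.reindex_bij_witness[where i = "\<lambda>i. int i + 1" and j = "\<lambda>a. nat (a - 1)"])
       (auto simp: m)
  also have "\<dots> = (\<Sum>i<n. - x\<^sup>2 * (?h (int i + 1) + ?h (int n - int i) + ?h (2 * int i + 1 - int n)))"
    by (rule sum.cong) (simp_all add: Phi_def m algebra_simps power2_eq_square)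
  also have "\<dots> = - x\<^sup>2 * (- 2 * int n * chi (int n + 1))"
    unfolding sum_distrib_left[symmetric] sum_chi_mult_triple ..
  finally show ?thesis by (simp add: m)
qed

text \<open>On a = b the first argument of the shifted \<open>Phi\<close> is 0, and with d = x + y
  the value does not depend on x.\<close>

lemma sum_Phi_diagonal_left:
  assumes "0 < d"
  shows "(\<Sum>x\<in>{1..d - 1}. Phi 0 a x d) = - 2 * (d - 1) * a * chi a * d\<^sup>2"
proof -
  have "Phi 0 a x d = - 2 * a * chi a * d\<^sup>2" for x
    by (simp add: Phi_def chi_minus algebra_simps power2_eq_square)
  then show ?thesis using assms by (simp add: algebra_simps)
qed

section \<open>Cancellation off the diagonals and the convolution identity\<close>

lemma sum_quads_trichotomy:
  fixes A B :: "int \<Rightarrow> int \<Rightarrow> int \<Rightarrow> int \<Rightarrow> int"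
  shows "(\<Sum>q\<in>quads N. g q) =
      (\<Sum>q\<in>{(a, b, x, y)\<in>quads N. A a b x y < B a b x y}. g q)
    + (\<Sum>q\<in>{(a, b, x, y)\<in>quads N. B a b x y < A a b x y}. g q)
    + (\<Sum>q\<in>{(a, b, x, y)\<in>quads N. A a b x y = B a b x y}. g q)" (is "_ = sum g ?L + sum g ?G + sum g ?E")
proof -
  have "quads N = (?L \<union> ?G) \<union> ?E" by auto
  moreover have "sum g ((?L \<union> ?G) \<union> ?E) = sum g (?L \<union> ?G) + sum g ?E"
    by (rule sum.union_disjoint) (auto intro: finite_subset[OF _ finite_quads[of N]])
  moreover have "sum g (?L \<union> ?G) = sum g ?L + sum g ?G"
    by (rule sum.union_disjoint) (auto intro: finite_subset[OF _ finite_quads[of N]])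
  ultimately show ?thesis by (simp only:)
qed

lemma sum_quads_Phi:
  "(\<Sum>(a, b, x, y)\<in>quads N. Phi a b x y - Phi (a - b) b x (x + y)) = 2 * (N - 1) * eis N"
proof -
  let ?M = "\<lambda>a b x y. Phi (a - b) b x (x + y)"
  have lt: "(\<Sum>(a, b, x, y)\<in>{(a, b, x, y)\<in>quads N. x < y}. Phi a b x y)
     = (\<Sum>(a, b, x, y)\<in>{(a, b, x, y)\<in>quads N. b < a}. ?M a b x y)"
    by (rule sum_quads_shift)
  \<comment> \<open>The shift matches only one pair of halves; the swap symmetries of
    \<open>Phi\<close> and of the shifted function carry this over to the other pair.\<close>
  have "(\<Sum>(a, b, x, y)\<in>{(a, b, x, y)\<in>quads N. y < x}. Phi a b x y)
     = (\<Sum>(a, b, x, y)\<in>{(a, b, x, y)\<in>quads N. x < y}. Phi a b x y)"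
    using sum_quads_swap[where P = "\<lambda>a b x y. x < y" and N = N and g = Phi] by (simp add: Phi_swap)
  moreover have "(\<Sum>(a, b, x, y)\<in>{(a, b, x, y)\<in>quads N. a < b}. ?M a b x y)
     = (\<Sum>(a, b, x, y)\<in>{(a, b, x, y)\<in>quads N. b < a}. ?M a b x y)"
    using sum_quads_swap[where P = "\<lambda>a b x y. b < a" and N = N and g = ?M] by (simp add: Phi_shift_swap)
  ultimately have gt: "(\<Sum>(a, b, x, y)\<in>{(a, b, x, y)\<in>quads N. y < x}. Phi a b x y)
     = (\<Sum>(a, b, x, y)\<in>{(a, b, x, y)\<in>quads N. a < b}. ?M a b x y)"
    using lt by simp
  have "(\<Sum>(a, b, x, y)\<in>quads N. Phi a b x y)
     = (\<Sum>(a, b, x, y)\<in>{(a, b, x, y)\<in>quads N. x < y}. Phi a b x y)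
     + (\<Sum>(a, b, x, y)\<in>{(a, b, x, y)\<in>quads N. y < x}. Phi a b x y)
     + (\<Sum>(a, b, x, y)\<in>{(a, b, x, y)\<in>quads N. x = y}. Phi a b x y)"
    by (rule sum_quads_trichotomy)
  moreover have "(\<Sum>(a, b, x, y)\<in>quads N. ?M a b x y)
     = (\<Sum>(a, b, x, y)\<in>{(a, b, x, y)\<in>quads N. a < b}. ?M a b x y)
     + (\<Sum>(a, b, x, y)\<in>{(a, b, x, y)\<in>quads N. b < a}. ?M a b x y)
     + (\<Sum>(a, b, x, y)\<in>{(a, b, x, y)\<in>quads N. a = b}. ?M a b x y)"
    by (rule sum_quads_trichotomy)
  ultimately have "(\<Sum>(a, b, x, y)\<in>quads N. Phi a b x y) - (\<Sum>(a, b, x, y)\<in>quads N. ?M a b x y)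
     = (\<Sum>(a, b, x, y)\<in>{(a, b, x, y)\<in>quads N. x = y}. Phi a b x y)
     - (\<Sum>(a, b, x, y)\<in>{(a, b, x, y)\<in>quads N. a = b}. ?M a b x y)"
    using lt gt by simp
  also have "(\<Sum>(a, b, x, y)\<in>{(a, b, x, y)\<in>quads N. x = y}. Phi a b x y)
     = (\<Sum>(a, d)\<in>factor_pairs N. 2 * (a - 1) * chi a * d\<^sup>2)"
    unfolding sum_quads_diagonal_right
    by (rule sum.cong) (auto simp: sum_Phi_diagonal_right factor_pairs_def)
  also have "(\<Sum>(a, b, x, y)\<in>{(a, b, x, y)\<in>quads N. a = b}. ?M a b x y)
     = (\<Sum>(a, d)\<in>factor_pairs N. - 2 * (d - 1) * a * chi a * d\<^sup>2)"
    unfolding sum_quads_diagonal_left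
    by (rule sum.cong) (auto simp: sum_Phi_diagonal_left factor_pairs_def)
  \<comment> \<open>Since a d = N, (a - 1) + (d - 1) a = N - 1 for every factorization.\<close>
  also have "(\<Sum>(a, d)\<in>factor_pairs N. 2 * (a - 1) * chi a * d\<^sup>2) - \<dots>
     = (\<Sum>(a, d)\<in>factor_pairs N. 2 * (N - 1) * (chi a * d\<^sup>2))"
    unfolding sum_subtractf[symmetric]
    by (rule sum.cong) (auto simp: factor_pairs_def algebra_simps power2_eq_square)
  finally show ?thesis
    by (simp add: eis_def sum_distrib_left sum_subtractf case_prod_beta)
qed

text \<open>The total in \<open>sum_quads_Phi\<close> is 3 times the sum of \<open>t\<close> plus 3
  times its swapped copy, and the copies are equal. By \<open>weight3_chi\<close>, \<open>t\<close>
  factors into a summand of \<open>wsigma\<close> and one of \<open>eis\<close>.\<close>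

lemma eis_convolution:
  "(N - 1) * eis N = 3 * (\<Sum>k\<in>{1..N - 1}. wsigma k * eis (N - k))"
proof -
  define t where "t = (\<lambda>a b (x::int) y. a * (chi (a - b) - chi (a + b)) * y\<^sup>2 :: int)"
  have "(\<Sum>(a, b, x, y)\<in>quads N. Phi a b x y - Phi (a - b) b x (x + y))
     = (\<Sum>(a, b, x, y)\<in>quads N. 3 * t a b x y + 3 * t b a y x)"
    unfolding Phi_minus_shift t_def ..
  also have "\<dots> = 3 * (\<Sum>(a, b, x, y)\<in>quads N. t a b x y) + 3 * (\<Sum>(a, b, x, y)\<in>quads N. t b a y x)"
    by (simp add: sum.distrib sum_distrib_left case_prod_beta)
  also have "(\<Sum>(a, b, x, y)\<in>quads N. t b a y x) = (\<Sum>(a, b, x, y)\<in>quads N. t a b x y)"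
    using sum_quads_swap[where P = "\<lambda>a b x y. True" and N = N and g = t] by simp
  finally have "2 * (N - 1) * eis N = 6 * (\<Sum>(a, b, x, y)\<in>quads N. t a b x y)"
    unfolding sum_quads_Phi by simp
  also have "(\<Sum>(a, b, x, y)\<in>quads N. t a b x y) =
    (\<Sum>k\<in>{1..N - 1}. \<Sum>(a, x)\<in>factor_pairs k. \<Sum>(b, y)\<in>factor_pairs (N - k). t a b x y)"
    unfolding sum_quads_convolution by simp
  also have "\<dots> = (\<Sum>k\<in>{1..N - 1}. wsigma k * eis (N - k))"
    unfolding wsigma_def eis_def t_def weight3_chi[symmetric] sum_product
    by (simp add: case_prod_beta algebra_simps)
  finally show ?thesis by (simp add: algebra_simps)
qed

subsection \<open>Hecke relations\<close>

definition eis_coprime :: "int \<Rightarrow> int \<Rightarrow> int" where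
  "eis_coprime p N = (\<Sum>(a, d)\<in>{(a, d)\<in>factor_pairs N. \<not> p dvd d}. chi a * d\<^sup>2)"

text \<open>If p does not divide d, it divides a by primality; removing one factor p from a costs
  \<open>chi p\<close> by multiplicativity.\<close>

lemma sum_factor_pairs_not_dvd:
  fixes p :: int
  assumes "prime p"
  shows "(\<Sum>(a, d)\<in>{(a, d)\<in>factor_pairs (p * N). \<not> p dvd d}. chi a * d\<^sup>2) = chi p * eis_coprime p N"
proof -
  have p: "0 < p" using assms by (simp add: prime_gt_0_int)
  have "(\<Sum>(a, d)\<in>{(a, d)\<in>factor_pairs (p * N). \<not> p dvd d}. chi a * d\<^sup>2)
      = (\<Sum>(a, d)\<in>{(a, d)\<in>factor_pairs N. \<not> p dvd d}. chi p * (chi a * d\<^sup>2))"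
  proof (rule sum.reindex_bij_witness[where
        i = "\<lambda>(a, d). (p * a, d)" and j = "\<lambda>(a, d). (a div p, d)"])
    fix q assume "q \<in> {(a, d)\<in>factor_pairs (p * N). \<not> p dvd d}"
    then obtain a d where q: "q = (a, d)" "0 < a" "0 < d" "a * d = p * N" "\<not> p dvd d"
      by (auto simp: factor_pairs_def)
    then have "p dvd a"
      using assms by (metis dvd_triv_left prime_dvd_mult_iff)
    then obtain c where c: "a = p * c" by (elim dvdE)
    show "(case case q of (a, d) \<Rightarrow> (a div p, d) of (a, d) \<Rightarrow> (p * a, d)) = q"
      using q p c by simp
    show "(case q of (a, d) \<Rightarrow> (a div p, d)) \<in> {(a, d)\<in>factor_pairs N. \<not> p dvd d}"
      using q p c by (auto simp: factor_pairs_def zero_less_mult_iff)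
    show "(case case q of (a, d) \<Rightarrow> (a div p, d) of (a, d) \<Rightarrow> chi p * (chi a * d\<^sup>2))
        = (case q of (a, d) \<Rightarrow> chi a * d\<^sup>2)"
      using q p c by (simp add: chi_mult)
  qed (use p in \<open>auto simp: factor_pairs_def\<close>)
  then show ?thesis
    by (simp add: eis_coprime_def sum_distrib_left case_prod_beta)
qed

lemma eis_coprime_mult_prime:
  "prime p \<Longrightarrow> eis_coprime p (p * N) = chi p * eis_coprime p N"
  using sum_factor_pairs_not_dvd by (simp add: eis_coprime_def)

text \<open>Factorizations of p N with p dividing d come from those of N by multiplying d by p,
  which gives the factor p^2.\<close>

lemma eis_mult_prime:
  assumes "prime p"
  shows "eis (p * N) = p\<^sup>2 * eis N + chi p * eis_coprime p N"
proof -
  have p: "0 < p" using assms by (simp add: prime_gt_0_int)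
  let ?A = "{(a, d)\<in>factor_pairs (p * N). p dvd d}" and ?B = "{(a, d)\<in>factor_pairs (p * N). \<not> p dvd d}"
  have "factor_pairs (p * N) = ?A \<union> ?B" by auto
  then have "eis (p * N) = (\<Sum>(a, d)\<in>?A \<union> ?B. chi a * d\<^sup>2)"
    unfolding eis_def by (simp only:)
  also have "\<dots> = (\<Sum>(a, d)\<in>?A. chi a * d\<^sup>2) + (\<Sum>(a, d)\<in>?B. chi a * d\<^sup>2)"
    by (rule sum.union_disjoint) (auto intro: finite_subset[OF _ finite_factor_pairs[of "p * N"]])
  also have "(\<Sum>(a, d)\<in>?A. chi a * d\<^sup>2) = (\<Sum>(a, d)\<in>factor_pairs N. p\<^sup>2 * (chi a * d\<^sup>2))"
    by (rule sum.reindex_bij_witness[where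
          i = "\<lambda>(a, d). (a, p * d)" and j = "\<lambda>(a, d). (a, d div p)"])
       (use p in \<open>auto simp: factor_pairs_def zero_less_mult_iff power_mult_distrib elim!: dvdE\<close>)
  also have "\<dots> = p\<^sup>2 * eis N"
    by (simp add: eis_def sum_distrib_left case_prod_beta)
  finally show ?thesis
    unfolding sum_factor_pairs_not_dvd[OF assms] .
qed

text \<open>Multiplying through by p^2 - chi p, the denominator of a geometric sum, keeps the
  identity in the integers and covers both residue classes of p at once.\<close>

lemma eis_prime_power:
  assumes "prime p"
  shows "(p\<^sup>2 - chi p) * eis (p ^ k * N)
     = (p ^ (2 * k) - chi p ^ k) * eis (p * N) - (chi p * p ^ (2 * k) - chi p ^ k * p\<^sup>2) * eis N"
proof -
  \<comment> \<open>Used with q = p^2, c = \<open>chi p\<close>, u = p^(2k), v = c^k; F and G stand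
    for \<open>eis\<close> at N and p N, H for \<open>eis_coprime p N\<close>.\<close>
  have step: "q * (u * (q - c) * F + (u - v) * (c * H)) + (q - c) * c * (v * H)
      = u * q * (q - c) * F + (u * q - c * v) * (c * H)" for q u c v F H :: int
    by (simp add: algebra_simps)
  have eliminate: "u * (q - c) * F + (u - v) * (G - q * F) = (u - v) * G - (c * u - v * q) * F"
    for q u c v F G :: int
    by (simp add: algebra_simps)
  have cop: "eis_coprime p (p ^ k * N) = chi p ^ k * eis_coprime p N" for k
    by (induction k) (simp_all add: eis_coprime_mult_prime[OF assms] mult.assoc)
  have "(p\<^sup>2 - chi p) * eis (p ^ k * N)
     = p ^ (2 * k) * (p\<^sup>2 - chi p) * eis N + (p ^ (2 * k) - chi p ^ k) * (chi p * eis_coprime p N)"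
  proof (induction k)
    case (Suc k)
    have "(p\<^sup>2 - chi p) * eis (p ^ Suc k * N)
        = p\<^sup>2 * ((p\<^sup>2 - chi p) * eis (p ^ k * N)) + (p\<^sup>2 - chi p) * chi p * (chi p ^ k * eis_coprime p N)"
      by (simp add: eis_mult_prime[OF assms] cop mult.assoc distrib_left)
    also have "\<dots> = p ^ (2 * k) * p\<^sup>2 * (p\<^sup>2 - chi p) * eis N
        + (p ^ (2 * k) * p\<^sup>2 - chi p * chi p ^ k) * (chi p * eis_coprime p N)"
      unfolding Suc.IH by (rule step)
    finally show ?case
      by (simp add: power_add[symmetric] mult_2)
  qed simp
  moreover have "chi p * eis_coprime p N = eis (p * N) - p\<^sup>2 * eis N"
    by (simp add: eis_mult_prime[OF assms])
  ultimately show ?thesis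
    by (simp only: eliminate)
qed

subsection \<open>Logarithmic derivative of the eta quotient\<close>

text \<open>The expansion of X^k / (1 - X^k) for positive k; the condition \<open>0 < n\<close>
  removes the constant term, as k divides 0.\<close>

definition lambert :: "nat \<Rightarrow> real fps" where
  "lambert k = Abs_fps (\<lambda>n. if k dvd n \<and> 0 < n then 1 else 0)"

lemma lambert_nth: "lambert k $ n = (if k dvd n \<and> 0 < n then 1 else 0)"
  by (simp add: lambert_def)

lemma lambert_mult: "0 < k \<Longrightarrow> (1 - fps_X ^ k) * lambert k = fps_X ^ k"
proof (rule fps_ext)
  fix n assume "0 < k"
  then show "((1 - fps_X ^ k) * lambert k) $ n = (fps_X ^ k :: real fps) $ n"
    by (cases "n = k"; cases "n < k")
       (auto simp: lambert_nth left_diff_distrib fps_X_power_mult_nth fps_X_power_nth dvd_minus_self dest: dvd_imp_le)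
qed

text \<open>L = X A' / A, written without a quotient so that products follow from the Leibniz rule.
  The factor X makes the n-th coefficient on the left n times that of A.\<close>

definition has_log_deriv :: "'a::field fps \<Rightarrow> 'a fps \<Rightarrow> bool" where
  "has_log_deriv A L \<longleftrightarrow> fps_X * fps_deriv A = A * L"

lemma has_log_deriv_mult:
  "has_log_deriv A L \<Longrightarrow> has_log_deriv B K \<Longrightarrow> has_log_deriv (A * B) (L + K)"
  unfolding has_log_deriv_def by (simp add: algebra_simps)

lemma has_log_deriv_power:
  "has_log_deriv A L \<Longrightarrow> has_log_deriv (A ^ n) (of_nat n * L)"
proof (induction n)
  case 0
  show ?case by (simp add: has_log_deriv_def)
next
  case (Suc n)
  then show ?case using has_log_deriv_mult[of A L "A ^ n" "of_nat n * L"] by (simp add: algebra_simps)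
qed

lemma has_log_deriv_prod:
  "(\<And>k. k \<in> S \<Longrightarrow> has_log_deriv (A k) (L k)) \<Longrightarrow> has_log_deriv (\<Prod>k\<in>S. A k) (\<Sum>k\<in>S. L k)"
proof (induction S rule: infinite_finite_induct)
  case (insert k S)
  then show ?case by (simp add: has_log_deriv_mult)
qed (simp_all add: has_log_deriv_def)

lemma has_log_deriv_inverse:
  assumes "has_log_deriv A L" "A $ 0 \<noteq> 0"
  shows "has_log_deriv (inverse A) (- L)"
proof -
  have 1: "A * inverse A = 1" using assms(2) by (simp add: inverse_mult_eq_1')
  then have "fps_deriv (A * inverse A) = 0" by simp
  then have 2: "A * fps_deriv (inverse A) = - (fps_deriv A * inverse A)"
    by (simp add: add_eq_0_iff)
  have "fps_X * fps_deriv (inverse A) = fps_X * inverse A * (A * fps_deriv (inverse A))"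
    using 1 by (metis (no_types, opaque_lifting) mult.assoc mult.commute mult_1)
  also have "\<dots> = - (inverse A * inverse A * (fps_X * fps_deriv A))"
    unfolding 2 by (simp add: algebra_simps)
  also have "\<dots> = - (inverse A * (A * inverse A) * L)"
    using assms(1) unfolding has_log_deriv_def by (simp add: algebra_simps)
  finally show ?thesis unfolding 1 has_log_deriv_def by simp
qed

lemma has_log_deriv_one_minus_X_power:
  assumes "0 < k"
  shows "has_log_deriv (1 - fps_X ^ k) (- of_nat k * lambert k)"
proof -
  have deriv: "fps_deriv (1 - fps_X ^ k :: real fps) = - of_nat k * fps_X ^ (k - 1)"
    by (simp add: fps_deriv_power fps_of_nat)
  have "fps_X * fps_X ^ (k - 1) = (1 - fps_X ^ k) * lambert k"
    unfolding lambert_mult[OF assms] using assms by (simp add: power_eq_if)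
  then have "fps_X * (- of_nat k * fps_X ^ (k - 1)) = - of_nat k * ((1 - fps_X ^ k) * lambert k)"
    by (simp only: mult.left_commute[of fps_X "- of_nat k" "fps_X ^ (k - 1)"])
  also have "\<dots> = (1 - fps_X ^ k) * (- of_nat k * lambert k)"
    by (rule mult.left_commute)
  finally show ?thesis
    unfolding has_log_deriv_def deriv .
qed

lemma has_log_deriv_B3_factor:
  assumes "0 < k"
  shows "has_log_deriv (B3_factor k) (of_nat (3 * k) * lambert k - of_nat (27 * k) * lambert (3 * k))"
proof -
  have "has_log_deriv (B3_factor k)
     (of_nat 9 * (- of_nat (3 * k) * lambert (3 * k)) + of_nat 3 * (- (- of_nat k * lambert k)))"
    unfolding B3_factor_def using assms
    by (intro has_log_deriv_mult has_log_deriv_power has_log_deriv_inverse has_log_deriv_one_minus_X_power) auto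
  then show ?thesis by (simp add: algebra_simps)
qed

text \<open>The divisors are taken inside 1..n rather than 1..j, to match the index range of the
  truncated product for all j up to n.\<close>

lemma wsigma_eq_divisor_sum:
  assumes "0 < j" "j \<le> n"
  shows "wsigma (int j) = (\<Sum>d\<in>{d\<in>{1..n}. d dvd j}. int d * weight3 (int d))"
  unfolding wsigma_def
proof (rule sum.reindex_bij_witness[where
      i = "\<lambda>d. (int d, int (j div d))" and j = "\<lambda>(a, x). nat a"])
  fix q assume "q \<in> factor_pairs (int j)"
  then obtain a x where q: "q = (a, x)" "0 < a" "0 < x" "a * x = int j"
    by (auto simp: factor_pairs_def)
  define b y where "b = nat a" and "y = nat x"
  have ax: "a = int b" "x = int y" "0 < b" "0 < y" using q by (simp_all add: b_def y_def)
  have j: "j = b * y" using q(4) unfolding ax by (metis of_nat_eq_iff of_nat_mult)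
  show "(int (case q of (a, x) \<Rightarrow> nat a), int (j div (case q of (a, x) \<Rightarrow> nat a))) = q"
    using q ax j by simp
  have "b \<le> n" using j ax(4) assms(2) mult_le_mono2[of 1 y b] by linarith
  then show "(case q of (a, x) \<Rightarrow> nat a) \<in> {d\<in>{1..n}. d dvd j}"
    using q(1) ax j by simp
  show "int (case q of (a, x) \<Rightarrow> nat a) * weight3 (int (case q of (a, x) \<Rightarrow> nat a))
      = (case q of (a, x) \<Rightarrow> a * weight3 a)"
    using q(1) ax by simp
next
  fix d assume d: "d \<in> {d\<in>{1..n}. d dvd j}"
  then obtain y where y: "j = d * y" by (auto elim: dvdE)
  with d assms(1) show "(int d, int (j div d)) \<in> factor_pairs (int j)"
    by (simp add: factor_pairs_def)
  show "(case (int d, int (j div d)) of (a, x) \<Rightarrow> nat a) = d"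
    by simp
qed

text \<open>A divisor d of j contributes 3 d; if d = 3 k it also contributes -27 k = -9 d. The total
  is 3 d times \<open>weight3\<close>.\<close>

lemma lambert_sum_nth:
  assumes "0 < j" "j \<le> n"
  shows "(\<Sum>k\<in>{1..n}. of_nat (3 * k) * lambert k - of_nat (27 * k) * lambert (3 * k)) $ j
      = real_of_int (3 * wsigma (int j))"
proof -
  let ?D = "{d\<in>{1..n}. d dvd j}" and ?T = "{d\<in>{1..n}. 3 * d dvd j}"
  have nth: "(of_nat c * lambert k) $ j = (if k dvd j then real c else 0)" for c k
    using assms by (simp add: lambert_nth fps_of_nat[symmetric])
  have "(\<Sum>k\<in>{1..n}. of_nat (3 * k) * lambert k - of_nat (27 * k) * lambert (3 * k)) $ j
     = (\<Sum>k\<in>?D. real (3 * k)) - (\<Sum>k\<in>?T. real (27 * k))"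
    unfolding fps_sum_nth fps_sub_nth nth sum_subtractf by (simp only: sum.inter_filter finite_atLeastAtMost)
  also have "(\<Sum>k\<in>?T. real (27 * k)) = (\<Sum>d\<in>{d\<in>?D. 3 dvd d}. real (9 * d))"
  proof (rule sum.reindex_bij_witness[where i = "\<lambda>d. d div 3" and j = "\<lambda>k. 3 * k"])
    fix k assume k: "k \<in> ?T"
    then have "3 * k \<le> j" using assms(1) by (auto intro: dvd_imp_le)
    then show "3 * k \<in> {d\<in>?D. 3 dvd d}" using k assms(2) by simp
  next
    fix d assume "d \<in> {d\<in>?D. 3 dvd d}"
    moreover from this obtain c where "d = 3 * c" by (auto elim: dvdE)
    ultimately show "d div 3 \<in> ?T" "3 * (d div 3) = d" by auto
  qed simp_all
  also have "(\<Sum>d\<in>{d\<in>?D. 3 dvd d}. real (9 * d)) = (\<Sum>d\<in>?D. if 3 dvd d then real (9 * d) else 0)"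
    by (rule sum.inter_filter) simp
  also have "(\<Sum>k\<in>?D. real (3 * k)) - \<dots> = (\<Sum>d\<in>?D. real_of_int (3 * (int d * weight3 (int d))))"
    unfolding sum_subtractf[symmetric]
    by (rule sum.cong) (auto simp: weight3_def int_dvd_int_iff[of 3, simplified])
  finally show ?thesis
    unfolding wsigma_eq_divisor_sum[OF assms] by (simp add: sum_distrib_left)
qed

section \<open>Identification of \<open>B3\<close> with the Eisenstein coefficients\<close>

lemma eis_1: "eis 1 = 1"
proof -
  have "factor_pairs 1 = {(1, 1)}"
    by (auto simp: factor_pairs_def zmult_eq_1_iff)
  then show ?thesis by (simp add: eis_def chi_values)
qed

lemma prod_B3_factor_nth_0: "(\<Prod>k\<in>{1..n}. B3_factor k) $ 0 = 1"
proof -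
  have "(\<Prod>k\<in>S. B3_factor k) $ 0 = 1" if "\<forall>k\<in>S. 0 < k" for S
    using that by (induction S rule: infinite_finite_induct) (auto simp: B3_factor_def fps_power_zeroth power_0_left)
  then show ?thesis by simp
qed

lemma B3_eq_eis: "B3 n = real_of_int (eis (int n + 1))"
proof -
  define P where "P = (\<Prod>k\<in>{1..n}. B3_factor k)"
  define L where "L = (\<Sum>k\<in>{1..n}. of_nat (3 * k) * lambert k - of_nat (27 * k) * lambert (3 * k))"
  have log_deriv: "fps_X * fps_deriv P = P * L"
    using has_log_deriv_prod[of "{1..n}" B3_factor] has_log_deriv_B3_factor
    unfolding P_def L_def has_log_deriv_def by simp
  have L_nth: "L $ j = real_of_int (3 * wsigma (int j))" if "0 < j" "j \<le> n" for j
    unfolding L_def using that by (rule lambert_sum_nth)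
  have L0: "L $ 0 = 0"
    unfolding L_def by (simp add: fps_sum_nth lambert_nth)
  \<comment> \<open>\<open>B3 n\<close> truncates the product at its own index, so n and
    \<open>P\<close> stay fixed while strong induction runs over the coefficients m up to n.\<close>
  have "P $ m = real_of_int (eis (int m + 1))" if "m \<le> n" for m
    using that
  proof (induction m rule: less_induct)
    case (less m)
    show ?case
    proof (cases "m = 0")
      case True
      show ?thesis unfolding True P_def prod_B3_factor_nth_0 by (simp add: eis_1)
    next
      case False
      have "real m * P $ m = (fps_X * fps_deriv P) $ m"
        using False by (simp add: of_nat_diff)
      also have "\<dots> = (\<Sum>i=0..m. P $ i * L $ (m - i))"
        unfolding log_deriv fps_mult_nth ..
      \<comment> \<open>The term i = m drops out because \<open>L\<close> has no constant term, so
        only earlier coefficients of \<open>P\<close> remain.\<close>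
      also have "\<dots> = (\<Sum>i<m. P $ i * L $ (m - i))"
        by (rule sum.mono_neutral_right) (auto simp: L0)
      also have "\<dots> = (\<Sum>i<m. real_of_int (3 * (wsigma (int (m - i)) * eis (int i + 1))))"
        using less by (intro sum.cong) (auto simp: L_nth)
      also have "\<dots> = (\<Sum>k\<in>{1..int m}. real_of_int (3 * (wsigma k * eis (int m + 1 - k))))"
        by (rule sum.reindex_bij_witness[where i = "\<lambda>k. nat (int m - k)" and j = "\<lambda>i. int (m - i)"])
           (auto simp: of_nat_diff add.commute)
      also have "\<dots> = real_of_int (int m * eis (int m + 1))"
        using eis_convolution[of "int m + 1"] by (simp add: sum_distrib_left)
      finally show ?thesis using False by simp
    qed
  qed
  then show ?thesis by (simp add: B3_def P_def)
qed

theorem theorem3p3: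
  fixes p k n :: nat
  assumes "prime p"
  shows "(p mod 3 = 1 \<longrightarrow>
           B3 (p ^ k * n + p ^ k - 1) =
             (real p ^ (2 * k) - 1) / (real p ^ 2 - 1) * B3 (p * n + p - 1)
           - (real p ^ (2 * k) - real p ^ 2) / (real p ^ 2 - 1) * B3 n)
       \<and> (p mod 3 = 2 \<longrightarrow>
           B3 (p ^ k * n + p ^ k - 1) =
             (real p ^ (2 * k) - (-1) ^ k) / (real p ^ 2 + 1) * B3 (p * n + p - 1)
           + (real p ^ (2 * k) + (-1) ^ k * real p ^ 2) / (real p ^ 2 + 1) * B3 n)"
proof -
  define N where "N = int n + 1"
  have p: "prime (int p)" "2 \<le> p"
    using assms by (auto simp: prime_ge_2_nat)
  \<comment> \<open>The index shift by one turns p^j n + p^j - 1 into p^j (n + 1); the natural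
    subtraction is exact since p^j is at least 1.\<close>
  have B3_power: "B3 (p ^ j * n + p ^ j - 1) = real_of_int (eis (int p ^ j * N))" for j
  proof -
    have "1 \<le> p ^ j" using p(2) by simp
    then have "int (p ^ j * n + p ^ j - 1) + 1 = int p ^ j * N"
      by (simp add: N_def of_nat_diff algebra_simps)
    then show ?thesis by (simp only: B3_eq_eis)
  qed
  have B3_p: "B3 (p * n + p - 1) = real_of_int (eis (int p * N))"
    using B3_power[of 1] by simp
  have B3_n: "B3 n = real_of_int (eis N)"
    by (simp add: B3_eq_eis N_def)
  have hecke: "(real p ^ 2 - c) * B3 (p ^ k * n + p ^ k - 1)
     = (real p ^ (2 * k) - c ^ k) * B3 (p * n + p - 1) - (c * real p ^ (2 * k) - c ^ k * real p ^ 2) * B3 n"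
    if "c = real_of_int (chi (int p))" for c
    using arg_cong[OF eis_prime_power[OF p(1), of k N], of real_of_int]
    unfolding B3_power B3_p B3_n that by simp
  have solve_diff: "x = u / d * y - v / d * z" if "d * x = u * y - v * z" "d \<noteq> 0" for d u v x y z :: real
    using that by (simp add: field_simps)
  have solve_add: "x = u / d * y + v / d * z" if "d * x = u * y + v * z" "d \<noteq> 0" for d u v x y z :: real
    using that by (simp add: field_simps)
  have "1 < real p ^ 2"
    using p(2) by (intro one_less_power) auto
  then have ne: "real p ^ 2 - 1 \<noteq> 0" "real p ^ 2 + 1 \<noteq> 0"
    by auto
  have mod3: "int p mod 3 = int (p mod 3)" by (simp add: of_nat_mod)
  show ?thesis
  proof (intro conjI impI)
    assume "p mod 3 = 1"
    then have "chi (int p) = 1" by (simp add: chi_def mod3)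
    with hecke[of 1] have "(real p ^ 2 - 1) * B3 (p ^ k * n + p ^ k - 1)
        = (real p ^ (2 * k) - 1) * B3 (p * n + p - 1) - (real p ^ (2 * k) - real p ^ 2) * B3 n"
      by simp
    from solve_diff[OF this ne(1)] show "B3 (p ^ k * n + p ^ k - 1) =
             (real p ^ (2 * k) - 1) / (real p ^ 2 - 1) * B3 (p * n + p - 1)
           - (real p ^ (2 * k) - real p ^ 2) / (real p ^ 2 - 1) * B3 n" .
  next
    assume "p mod 3 = 2"
    then have "chi (int p) = - 1" by (simp add: chi_def mod3)
    \<comment> \<open>For c = -1 the coefficient of \<open>B3 n\<close> is -(-p^(2k) - (-1)^k p^2),
      hence the plus signs.\<close>
    with hecke[of "- 1"] have "(real p ^ 2 + 1) * B3 (p ^ k * n + p ^ k - 1)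
        = (real p ^ (2 * k) - (-1) ^ k) * B3 (p * n + p - 1) + (real p ^ (2 * k) + (-1) ^ k * real p ^ 2) * B3 n"
      by (simp add: algebra_simps)
    from solve_add[OF this ne(2)] show "B3 (p ^ k * n + p ^ k - 1) =
             (real p ^ (2 * k) - (-1) ^ k) / (real p ^ 2 + 1) * B3 (p * n + p - 1)
           + (real p ^ (2 * k) + (-1) ^ k * real p ^ 2) / (real p ^ 2 + 1) * B3 n" .
  qed
qed

end
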